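(* Let $N=(\Gamma,B)$ be a network and $\mathbb{K}$ a field. The Dirichlet matroid $M(N)$ is representable over $\mathbb{K}$ if and only if $|\mathbb{K}|\ge\max_U|U\cap B|$, where the maximum runs over all blocks $U$ of $N$.
   Context: A network $N=(\Gamma,B)$ consists of a finite connected graph $\Gamma=(V,E)$ with no loops or multiple edges and a set $B\subsetneq V$ of at least 2 vertices (boundary nodes), no two of which are adjacent; vertices in $V\setminus B$ are interior. The Dirichlet matroid $M(N)$: fix an injective $u:B\to\mathbb{R}$ and a new symbol $e_0\notin E$; in $\mathbb{R}^{(V\setminus B)\cup\{0\}}$ assign to each edge $ij$ with $i,j$ interior the vector $\mathbf{e}_i-\mathbf{e}_j$, to each edge $ij$ with $i$ interior and $j\in B$ the vector $\mathbf{e}_i-u(j)\mathbf{e}_0$, and to $e_0$ the vector $\mathbf{e}_0$; $M(N)$ is the matroid of linear independence of these vectors on $E\cup\{e_0\}$ (independent of the choice of injective $u$). For an interior vertex $i$, the block of $N$ containing $i$ is the set of all $j\in V$ for which there is a path $i_1\cdots i_k$ in $\Gamma$ with $i_1=i$, $i_k=j$, and $i_1,\dots,i_{k-1}$ all interior. *)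

theory Defs
  imports
    Complex_Main
    "HOL-Library.Function_Algebras"
    "HOL-Library.Equipollence"
begin

definition fun_scale :: "'k::field \<Rightarrow> ('i \<Rightarrow> 'k) \<Rightarrow> 'i \<Rightarrow> 'k" where
  "fun_scale c x = (\<lambda>i. c * x i)"

interpretation fun_vs: vector_space "fun_scale :: 'k::field \<Rightarrow> ('i \<Rightarrow> 'k) \<Rightarrow> 'i \<Rightarrow> 'k"
  by unfold_locales (auto simp: fun_scale_def fun_eq_iff algebra_simps)

definition unit_vec :: "'i \<Rightarrow> 'i \<Rightarrow> 'k::field" where
  "unit_vec i = (\<lambda>j. if j = i then 1 else 0)"

text \<open>Independence of the family indexed by \<open>X\<close>, so a repeated vector makes it dependent.\<close>

definition indep_family :: "('e \<Rightarrow> 'i \<Rightarrow> 'k::field) \<Rightarrow> 'e set \<Rightarrow> bool" where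
  "indep_family v X \<longleftrightarrow> inj_on v X \<and> fun_vs.independent (v ` X)"

text \<open>A matroid is encoded as the pair of its ground set and its collection of independent sets.\<close>

type_synonym 'e matroid = "'e set \<times> 'e set set"

definition is_matroid :: "'e matroid \<Rightarrow> bool" where
  "is_matroid M \<longleftrightarrow> (case M of (S, \<I>) \<Rightarrow>
     finite S \<and> \<I> \<subseteq> Pow S \<and> {} \<in> \<I> \<and>
     (\<forall>X\<in>\<I>. \<forall>Y\<subseteq>X. Y \<in> \<I>) \<and>
     (\<forall>X\<in>\<I>. \<forall>Y\<in>\<I>. card X < card Y \<longrightarrow> (\<exists>y\<in>Y - X. insert y X \<in> \<I>)))"

definition vector_matroid :: "'e set \<Rightarrow> ('e \<Rightarrow> 'i \<Rightarrow> 'k::field) \<Rightarrow> 'e matroid" where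
  "vector_matroid S v = (S, {X. X \<subseteq> S \<and> indep_family v X})"

lemma is_matroid_vector_matroid:
  fixes v :: "'e \<Rightarrow> 'i \<Rightarrow> 'k::field"
  assumes fin: "finite S"
  shows "is_matroid (vector_matroid S v)"
proof -
  have empty: "indep_family v {}"
    by (simp add: indep_family_def fun_vs.independent_empty)
  have mono: "indep_family v Y" if "indep_family v X" "Y \<subseteq> X" for X Y
    using that fun_vs.independent_mono[of "v ` X" "v ` Y"]
    by (auto simp: indep_family_def inj_on_subset)
  have aug: "\<exists>y\<in>Y - X. insert y X \<subseteq> S \<and> indep_family v (insert y X)"
    if X: "X \<subseteq> S" "indep_family v X" and Y: "Y \<subseteq> S" "indep_family v Y"
      and card: "card X < card Y" for X Y
  proof -
    have finX: "finite (v ` X)" using X fin by (meson finite_imageI finite_subset)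
    have "\<not> v ` Y \<subseteq> fun_vs.span (v ` X)"
    proof
      assume "v ` Y \<subseteq> fun_vs.span (v ` X)"
      then have "card (v ` Y) \<le> card (v ` X)"
        using fun_vs.independent_span_bound[OF finX] Y by (auto simp: indep_family_def)
      then show False
        using card X Y by (simp add: card_image indep_family_def)
    qed
    then obtain y where y: "y \<in> Y" "v y \<notin> fun_vs.span (v ` X)" by auto
    then have "v y \<notin> v ` X" using fun_vs.span_base by blast
    then have "y \<notin> X" by blast
    moreover have "indep_family v (insert y X)"
      using X y \<open>v y \<notin> v ` X\<close> \<open>y \<notin> X\<close>
      by (auto simp: indep_family_def fun_vs.independent_insert)
    ultimately show ?thesis using X Y y by blast
  qed
  show ?thesis
    unfolding is_matroid_def vector_matroid_def
    using fin empty mono aug by auto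
qed

text \<open>\<open>K\<^sup>n\<close> is realised as the space of functions on \<open>nat\<close> vanishing outside \<open>{..<n}\<close>.\<close>

definition representable :: "'k::field itself \<Rightarrow> 'e matroid \<Rightarrow> bool" where
  "representable (_ :: 'k itself) M \<longleftrightarrow>
     (\<exists>(n::nat) (\<phi> :: 'e \<Rightarrow> nat \<Rightarrow> 'k).
        (\<forall>e\<in>fst M. \<forall>i\<ge>n. \<phi> e i = 0) \<and> M = vector_matroid (fst M) \<phi>)"

text \<open>Edges are two-element sets of vertices.\<close>

definition is_path :: "'v set \<Rightarrow> 'v set set \<Rightarrow> 'v list \<Rightarrow> bool" where
  "is_path V E p \<longleftrightarrow> p \<noteq> [] \<and> distinct p \<and> set p \<subseteq> V \<and>
     (\<forall>k. Suc k < length p \<longrightarrow> {p ! k, p ! Suc k} \<in> E)"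

locale network =
  fixes V :: "'v set" and E :: "'v set set" and B :: "'v set"
  assumes finite_V: "finite V"
    and edges: "E \<subseteq> {{i, j} | i j. i \<in> V \<and> j \<in> V \<and> i \<noteq> j}"
    and connected: "\<And>i j. i \<in> V \<Longrightarrow> j \<in> V \<Longrightarrow> \<exists>p. is_path V E p \<and> hd p = i \<and> last p = j"
    and boundary: "B \<subset> V" "2 \<le> card B"
    and boundary_nonadjacent: "\<And>i j. i \<in> B \<Longrightarrow> j \<in> B \<Longrightarrow> {i, j} \<notin> E"

definition block :: "'v set \<Rightarrow> 'v set set \<Rightarrow> 'v set \<Rightarrow> 'v \<Rightarrow> 'v set" where
  "block V E B i = {j \<in> V. \<exists>p. is_path V E p \<and> hd p = i \<and> last p = j \<and> set (butlast p) \<subseteq> V - B}"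

definition blocks :: "'v set \<Rightarrow> 'v set set \<Rightarrow> 'v set \<Rightarrow> 'v set set" where
  "blocks V E B = block V E B ` (V - B)"

text \<open>
  Coordinates are indexed by \<open>'v option\<close>: \<open>None\<close> stands for the extra index \<open>0\<close>, and only
  coordinates \<open>Some i\<close> with \<open>i\<close> interior are ever nonzero. For an edge with both ends interior,
  \<open>SOME\<close> merely fixes an orientation, i.e. the sign of the vector, which does not affect linear
  independence; for an edge meeting \<open>B\<close> the vector is uniquely determined.
\<close>

definition dirichlet_edge_vec :: "'v set \<Rightarrow> 'v set \<Rightarrow> ('v \<Rightarrow> real) \<Rightarrow> 'v set \<Rightarrow> 'v option \<Rightarrow> real" where
  "dirichlet_edge_vec V B u e = (SOME w. \<exists>i j. e = {i, j} \<and> i \<in> V - B \<and>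
     ((j \<in> V - B \<and> w = unit_vec (Some i) - unit_vec (Some j)) \<or>
      (j \<in> B \<and> w = unit_vec (Some i) - fun_scale (u j) (unit_vec None))))"

text \<open>In the ground set, \<open>None\<close> is the new element \<open>e\<^sub>0\<close> and \<open>Some e\<close> is the edge \<open>e\<close>.\<close>

definition dirichlet_vec ::
    "'v set \<Rightarrow> 'v set \<Rightarrow> ('v \<Rightarrow> real) \<Rightarrow> 'v set option \<Rightarrow> 'v option \<Rightarrow> real" where
  "dirichlet_vec V B u x = (case x of None \<Rightarrow> unit_vec None | Some e \<Rightarrow> dirichlet_edge_vec V B u e)"

definition dirichlet_matroid ::
    "'v set \<Rightarrow> 'v set set \<Rightarrow> 'v set \<Rightarrow> ('v \<Rightarrow> real) \<Rightarrow> 'v set option matroid" where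
  "dirichlet_matroid V E B u = vector_matroid (insert None (Some ` E)) (dirichlet_vec V B u)"

end

theory Submission imports Defs begin

text \<open>
  If \<open>K\<close> is large enough, replace \<open>u\<close> by weights in \<open>K\<close> that may differ from block to block but are
  injective on the boundary of each block. Every vector, including that of \<open>e\<^sub>0\<close>, is a difference
  of the vectors of two labels. Gaussian elimination at an interior coordinate identifies two labels
  of the same block, so by induction the real and the \<open>K\<close>-configuration reduce in parallel, and only
  equality of weights within one block is ever tested.

  Conversely, contracting a spanning forest \<open>T\<close> of the interior of a block leaves \<open>e\<^sub>0\<close> and one edge for
  each of the \<open>m\<close> boundary nodes of the block, any two independent and all in a plane. In a
  representation over \<open>K\<close> the \<open>m\<close> edges are distinct directions other than \<open>e\<^sub>0\<close>, so their slopes are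
  \<open>m\<close> distinct elements of \<open>K\<close>.
\<close>

section \<open>Linear independence of families and elimination of a pivot\<close>

lemma sum_fun_at: "(\<Sum>x\<in>A. f x) i = (\<Sum>x\<in>A. f x i :: 'k::field)"
  by (induction A rule: infinite_finite_induct) auto

text \<open>Injectivity needs no separate test: if \<open>v x = v y\<close> with
  \<open>x \<noteq> y\<close>, the coefficients 1 at \<open>x\<close> and -1 at \<open>y\<close>
  already give a nontrivial relation.\<close>

lemma indep_family_iff_coeffs:
  fixes v :: "'e \<Rightarrow> 'i \<Rightarrow> 'k::field"
  assumes fin: "finite X"
  shows "indep_family v X \<longleftrightarrow>
    (\<forall>a. (\<forall>i. (\<Sum>e\<in>X. a e * v e i) = 0) \<longrightarrow> (\<forall>e\<in>X. a e = 0))" (is "?l \<longleftrightarrow> ?r")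
proof
  assume l: ?l
  then have inj: "inj_on v X" and ind: "fun_vs.independent (v ` X)"
    by (auto simp: indep_family_def)
  show ?r
  proof (intro allI impI ballI)
    fix a e assume a: "\<forall>i. (\<Sum>e\<in>X. a e * v e i) = 0" and e: "e \<in> X"
    let ?u = "\<lambda>x. a (the_inv_into X v x)"
    have "(\<Sum>x\<in>v ` X. fun_scale (?u x) x) = (\<Sum>e\<in>X. fun_scale (a e) (v e))"
      by (simp add: sum.reindex[OF inj] the_inv_into_f_f[OF inj])
    also have "\<dots> = 0"
      using a by (simp add: fun_eq_iff sum_fun_at fun_scale_def)
    finally have "\<not> (\<exists>x\<in>v ` X. ?u x \<noteq> 0)"
      using ind unfolding fun_vs.dependent_finite[OF finite_imageI[OF fin]] by fast
    then have "?u (v e) = 0" using e by fast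
    then show "a e = 0" by (simp add: the_inv_into_f_f[OF inj e])
  qed
next
  assume r: ?r
  have inj: "inj_on v X"
  proof (rule inj_onI, rule ccontr)
    fix x y assume xy: "x \<in> X" "y \<in> X" "v x = v y" "x \<noteq> y"
    let ?a = "\<lambda>e. (if e = x then 1 else 0) - (if e = y then 1 else 0 :: 'k)"
    have "(\<Sum>e\<in>X. ?a e * v e i) = 0" for i
      using xy fin by (simp add: left_diff_distrib sum_subtractf if_distrib[of "\<lambda>c. c * _"] cong: if_cong)
    then have "?a x = 0" using r[rule_format, of ?a x] xy(1) by blast
    then show False using xy by simp
  qed
  moreover have "fun_vs.independent (v ` X)"
  proof
    assume "fun_vs.dependent (v ` X)"
    then obtain u where u: "\<exists>x\<in>v ` X. u x \<noteq> 0" "(\<Sum>x\<in>v ` X. fun_scale (u x) x) = 0"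
      using fun_vs.dependent_finite[OF finite_imageI[OF fin], of v] by blast
    then have "(\<Sum>e\<in>X. fun_scale (u (v e)) (v e)) = 0"
      by (simp add: sum.reindex[OF inj])
    then have "\<forall>i. (\<Sum>e\<in>X. u (v e) * v e i) = 0"
      by (simp add: fun_eq_iff sum_fun_at fun_scale_def)
    then have "\<forall>e\<in>X. u (v e) = 0" using r[rule_format, of "\<lambda>e. u (v e)"] by blast
    then show False using u by blast
  qed
  ultimately show ?l by (simp add: indep_family_def)
qed

lemma indep_family_cong: "(\<And>e. e \<in> X \<Longrightarrow> v e = w e) \<Longrightarrow> indep_family v X \<longleftrightarrow> indep_family w X"
  by (simp add: indep_family_def cong: inj_on_cong image_cong)

lemma indep_family_insert:
  assumes "y \<notin> X"
  shows "indep_family v (insert y X) \<longleftrightarrow> indep_family v X \<and> v y \<notin> fun_vs.span (v ` X)"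
  using assms fun_vs.span_base[of "v y" "v ` X"]
  by (auto simp: indep_family_def fun_vs.independent_insert)

lemma indep_family_nonzero: "indep_family v X \<Longrightarrow> e \<in> X \<Longrightarrow> v e \<noteq> 0"
  using fun_vs.dependent_zero[of "v ` X"] by (auto simp: indep_family_def)

text \<open>One step of Gaussian elimination. Coordinate \<open>c\<close> forces the coefficient of
  \<open>y\<close> in any relation on \<open>insert y X\<close>, so these relations correspond to
  the relations among the vectors of \<open>X\<close> with coordinate \<open>c\<close>
  cleared.\<close>

lemma indep_family_pivot:
  fixes v :: "'e \<Rightarrow> 'i \<Rightarrow> 'k::field"
  assumes fin: "finite X" and y: "y \<notin> X" and c: "v y c \<noteq> 0"
  shows "indep_family v (insert y X) \<longleftrightarrow>
    indep_family (\<lambda>e. v e - fun_scale (v e c / v y c) (v y)) X"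
proof -
  let ?w = "\<lambda>e i. v e i - v e c / v y c * v y i"
  have sum_w: "(\<Sum>e\<in>X. a e * ?w e i) =
      (\<Sum>e\<in>X. a e * v e i) - (\<Sum>e\<in>X. a e * v e c) / v y c * v y i" for a :: "'e \<Rightarrow> 'k" and i
  proof -
    have "(\<Sum>e\<in>X. a e * (v e c / v y c * v y i)) = (\<Sum>e\<in>X. a e * v e c * (v y i / v y c))"
      by (rule sum.cong) simp_all
    also have "\<dots> = (\<Sum>e\<in>X. a e * v e c) / v y c * v y i"
      by (subst sum_distrib_right[symmetric]) simp
    finally show ?thesis
      by (simp only: right_diff_distrib sum_subtractf)
  qed
  have w: "(\<lambda>e. v e - fun_scale (v e c / v y c) (v y)) = ?w"
    by (simp add: fun_eq_iff fun_scale_def)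
  have "(\<forall>a. (\<forall>i. (\<Sum>e\<in>insert y X. a e * v e i) = 0) \<longrightarrow> (\<forall>e\<in>insert y X. a e = 0)) \<longleftrightarrow>
    (\<forall>a. (\<forall>i. (\<Sum>e\<in>X. a e * ?w e i) = 0) \<longrightarrow> (\<forall>e\<in>X. a e = 0))" (is "?l \<longleftrightarrow> ?r")
  proof
    assume l: ?l
    show ?r
    proof (intro allI impI)
      fix a assume a: "\<forall>i. (\<Sum>e\<in>X. a e * ?w e i) = 0"
      \<comment> \<open>The new coefficient collects the multiples of \<open>v y\<close> that were
        subtracted from the vectors of \<open>X\<close>.\<close>
      let ?b = "a(y := - (\<Sum>e\<in>X. a e * v e c) / v y c)"
      have b: "(\<Sum>e\<in>X. ?b e * v e i) = (\<Sum>e\<in>X. a e * v e i)" for i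
        using y by (intro sum.cong) auto
      have "(\<Sum>e\<in>insert y X. ?b e * v e i) = (\<Sum>e\<in>X. a e * ?w e i)" for i
        unfolding sum.insert[OF fin y] sum_w b fun_upd_same
        by (simp only: minus_divide_left[symmetric] mult_minus_left add.commute[of "- _"] add_uminus_conv_diff)
      then have "\<forall>i. (\<Sum>e\<in>insert y X. ?b e * v e i) = 0"
        using a by (simp only: simp_thms)
      then have "\<forall>e\<in>insert y X. ?b e = 0" using l by blast
      then show "\<forall>e\<in>X. a e = 0" using y by (metis fun_upd_other insertCI)
    qed
  next
    assume r: ?r
    show ?l
    proof (intro allI impI)
      fix a assume "\<forall>i. (\<Sum>e\<in>insert y X. a e * v e i) = 0"
      then have a: "a y * v y i + (\<Sum>e\<in>X. a e * v e i) = 0" for i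
        using fin y by simp
      have s: "(\<Sum>e\<in>X. a e * v e i) = - (a y * v y i)" for i
        by (rule minus_unique[OF a, symmetric])
      have "\<forall>i. (\<Sum>e\<in>X. a e * ?w e i) = 0"
        unfolding sum_w s using c by simp
      then have X: "\<forall>e\<in>X. a e = 0" using r by blast
      then have "a y = 0" using a[of c] c by simp
      with X show "\<forall>e\<in>insert y X. a e = 0" by blast
    qed
  qed
  then show ?thesis
    unfolding w indep_family_iff_coeffs[OF fin] indep_family_iff_coeffs[OF finite.insertI[OF fin]] .
qed

section \<open>Parallel elimination over two fields\<close>

text \<open>Labels in \<open>I\<close> play the interior vertices; all others are multiples of the
  one direction \<open>unit_vec z\<close>, with weights \<open>u\<close>. Differences of label
  vectors cover interior edges, boundary edges and \<open>e\<^sub>0\<close> alike, and elimination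
  preserves this form.\<close>

definition label_vec :: "('l \<Rightarrow> 'i) \<Rightarrow> 'i \<Rightarrow> 'l set \<Rightarrow> ('l \<Rightarrow> 'k::field) \<Rightarrow> 'l \<Rightarrow> 'i \<Rightarrow> 'k" where
  "label_vec \<kappa> z I u l = (if l \<in> I then unit_vec (\<kappa> l) else fun_scale (u l) (unit_vec z))"

text \<open>Among all label vectors only that of \<open>i\<close> is nonzero at
  \<open>\<kappa> i\<close>, so clearing this coordinate replaces the vector of \<open>i\<close> by
  that of \<open>p\<close> and changes no other. This contracts the edge \<open>y\<close>; its
  orientation is irrelevant because a pivot may be rescaled.\<close>

lemma label_vec_pivot_interior:
  fixes u :: "'l \<Rightarrow> 'k::field" and \<kappa> :: "'l \<Rightarrow> 'i"
  assumes inj: "inj_on \<kappa> I" and z: "z \<notin> \<kappa> ` I" and fin: "finite X" and y: "y \<notin> X"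
    and i: "i \<in> I" "p \<noteq> i" "s y = i \<and> t y = p \<or> s y = p \<and> t y = i"
  defines "m \<equiv> (\<lambda>l. if l = i then p else l)"
  shows "indep_family (\<lambda>e. label_vec \<kappa> z I u (s e) - label_vec \<kappa> z I u (t e)) (insert y X) \<longleftrightarrow>
    indep_family (\<lambda>e. label_vec \<kappa> z I u (m (s e)) - label_vec \<kappa> z I u (m (t e))) X"
proof -
  let ?f = "label_vec \<kappa> z I u"
  have at: "?f l (\<kappa> i) = (if l = i then 1 else 0)" for l
    using inj z i by (auto simp: label_vec_def unit_vec_def fun_scale_def inj_on_def)
  have m: "?f (m l) = ?f l - fun_scale (?f l (\<kappa> i)) (?f i - ?f p)" for l
    by (auto simp: m_def at fun_scale_def fun_eq_iff)
  show ?thesis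
    by (subst indep_family_pivot[OF fin y, where c = "\<kappa> i"])
      (use i in \<open>auto simp: at m fun_scale_def fun_eq_iff algebra_simps intro!: indep_family_cong\<close>)
qed

text \<open>The pivot is a nonzero multiple of \<open>unit_vec z\<close>. Clearing coordinate
  \<open>z\<close> kills every boundary label, which amounts to setting all weights to 0.\<close>

lemma label_vec_pivot_boundary:
  fixes u :: "'l \<Rightarrow> 'k::field" and \<kappa> :: "'l \<Rightarrow> 'i"
  assumes z: "z \<notin> \<kappa> ` I" and fin: "finite X" and y: "y \<notin> X"
    and st: "s y \<notin> I" "t y \<notin> I" "u (s y) \<noteq> u (t y)"
  shows "indep_family (\<lambda>e. label_vec \<kappa> z I u (s e) - label_vec \<kappa> z I u (t e)) (insert y X) \<longleftrightarrow>
    indep_family (\<lambda>e. label_vec \<kappa> z I (\<lambda>_. 0 :: 'k) (s e) - label_vec \<kappa> z I (\<lambda>_. 0 :: 'k) (t e)) X"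
proof -
  let ?f = "label_vec \<kappa> z I u"
  have at: "?f l z = (if l \<in> I then 0 else u l)" for l
    using z by (auto simp: label_vec_def unit_vec_def fun_scale_def)
  have m: "label_vec \<kappa> z I (\<lambda>_. 0 :: 'k) l = ?f l - fun_scale (?f l z) (unit_vec z)" for l
    using z by (auto simp: at) (auto simp: label_vec_def fun_scale_def fun_eq_iff unit_vec_def)
  have y': "?f (s y) - ?f (t y) = fun_scale (u (s y) - u (t y)) (unit_vec z)"
    using st by (simp add: label_vec_def fun_vs.scale_left_diff_distrib)
  have c: "(?f (s y) - ?f (t y)) z = u (s y) - u (t y)"
    by (simp add: y' fun_scale_def unit_vec_def)
  have sc: "fun_scale (r / (?f (s y) - ?f (t y)) z) (?f (s y) - ?f (t y)) = fun_scale r (unit_vec z)" for r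
    unfolding c unfolding y' using st by simp
  have eq: "(\<lambda>e. label_vec \<kappa> z I (\<lambda>_. 0 :: 'k) (s e) - label_vec \<kappa> z I (\<lambda>_. 0 :: 'k) (t e)) =
      (\<lambda>e. (?f (s e) - ?f (t e)) - fun_scale ((?f (s e) - ?f (t e)) z / (?f (s y) - ?f (t y)) z)
        (?f (s y) - ?f (t y)))"
    unfolding sc m by (simp add: fun_eq_iff fun_scale_def algebra_simps)
  have "(?f (s y) - ?f (t y)) z \<noteq> 0" using c st by simp
  note indep_family_pivot[where v = "\<lambda>e. ?f (s e) - ?f (t e)" and c = z, OF fin y this]
  also note arg_cong[OF eq, of "\<lambda>v. indep_family v X", symmetric]
  finally show ?thesis .
qed

text \<open>Both families are eliminated with the same \<open>y\<close>. The ends and the weights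
  are generalised in the induction because a pivot changes one or the other. The hypotheses survive:
  a contraction identifies labels of one class only, and constant zero weights agree trivially on
  both sides.\<close>

lemma indep_family_label_vec_eq:
  fixes u1 :: "'l \<Rightarrow> 'k::field" and u2 :: "'l \<Rightarrow> 'm::field"
    and \<kappa>1 :: "'l \<Rightarrow> 'i" and \<kappa>2 :: "'l \<Rightarrow> 'j"
  assumes fin: "finite X"
    and \<kappa>: "inj_on \<kappa>1 I" "z1 \<notin> \<kappa>1 ` I" "inj_on \<kappa>2 I" "z2 \<notin> \<kappa>2 ` I"
    and "\<And>l l'. l \<in> L - I \<Longrightarrow> l' \<in> L - I \<Longrightarrow> cls l = cls l' \<Longrightarrow> u1 l = u1 l' \<longleftrightarrow> u2 l = u2 l'"
    and "\<And>e. e \<in> X \<Longrightarrow> s e \<in> L \<and> t e \<in> L \<and> cls (s e) = cls (t e)"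
  shows "indep_family (\<lambda>e. label_vec \<kappa>1 z1 I u1 (s e) - label_vec \<kappa>1 z1 I u1 (t e)) X \<longleftrightarrow>
    indep_family (\<lambda>e. label_vec \<kappa>2 z2 I u2 (s e) - label_vec \<kappa>2 z2 I u2 (t e)) X"
  using fin assms(6-)
proof (induction X arbitrary: s t u1 u2)
  case empty
  then show ?case by (simp add: indep_family_def fun_vs.independent_empty)
next
  case (insert y X)
  note u = insert.prems(1) and st = insert.prems(2)
  have sty: "s y \<in> L" "t y \<in> L" "cls (s y) = cls (t y)" using st by auto
  have interior: ?case
    if i: "i \<in> I" "p \<noteq> i" "s y = i \<and> t y = p \<or> s y = p \<and> t y = i" for i p
  proof -
    let ?m = "\<lambda>l. if l = i then p else l"
    have "?m (s e) \<in> L \<and> ?m (t e) \<in> L \<and> cls (?m (s e)) = cls (?m (t e))" if "e \<in> X" for e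
      using st[of e] that sty i by auto
    then show ?thesis
      using insert.IH[of u1 u2 "\<lambda>e. ?m (s e)" "\<lambda>e. ?m (t e)"] u
      unfolding label_vec_pivot_interior[where s = s and t = t, OF \<kappa>(1,2) insert.hyps i]
        label_vec_pivot_interior[where s = s and t = t, OF \<kappa>(3,4) insert.hyps i] by blast
  qed
  consider (loop) "s y = t y \<or> s y \<notin> I \<and> t y \<notin> I \<and> u1 (s y) = u1 (t y)"
    | (int) "s y \<noteq> t y" "s y \<in> I \<or> t y \<in> I"
    | (bd) "s y \<notin> I" "t y \<notin> I" "u1 (s y) \<noteq> u1 (t y)" by blast
  then show ?case
  proof cases
    case loop
    \<comment> \<open>The vector of \<open>y\<close> vanishes over both fields, so both families are
      dependent.\<close>
    then have "label_vec \<kappa>1 z1 I u1 (s y) - label_vec \<kappa>1 z1 I u1 (t y) = 0"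
      by (auto simp: label_vec_def)
    moreover have "label_vec \<kappa>2 z2 I u2 (s y) - label_vec \<kappa>2 z2 I u2 (t y) = 0"
      using loop u[of "s y" "t y"] sty by (auto simp: label_vec_def)
    ultimately show ?thesis
      using indep_family_nonzero[of "\<lambda>e. label_vec \<kappa>1 z1 I u1 (s e) - label_vec \<kappa>1 z1 I u1 (t e)" "insert y X" y]
        indep_family_nonzero[of "\<lambda>e. label_vec \<kappa>2 z2 I u2 (s e) - label_vec \<kappa>2 z2 I u2 (t e)" "insert y X" y]
      by blast
  next
    case int
    then show ?thesis using interior[of "s y" "t y"] interior[of "t y" "s y"] by argo
  next
    case bd
    \<comment> \<open>Both ends lie in one class, where inequality of weights transfers; hence
      \<open>y\<close> is a pivot over the second field too.\<close>
    then have u2: "u2 (s y) \<noteq> u2 (t y)" using u[of "s y" "t y"] sty by blast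
    show ?thesis
      using insert.IH[of "\<lambda>_. 0" "\<lambda>_. 0" s t] st
      unfolding label_vec_pivot_boundary[where s = s and t = t and u = u1, OF \<kappa>(2) insert.hyps bd]
        label_vec_pivot_boundary[where s = s and t = t and u = u2, OF \<kappa>(4) insert.hyps bd(1,2) u2]
      by blast
  qed
qed

section \<open>Paths and blocks\<close>

context network
begin

lemma interior_in_own_block: "i \<in> V - B \<Longrightarrow> i \<in> block V E B i"
  unfolding block_def is_path_def by (auto intro!: exI[of _ "[i]"])

text \<open>Since \<open>k\<close> is interior, so is the whole path to it, and \<open>j\<close> can
  be appended. Paths must be distinct, so if \<open>j\<close> already occurs, the path is cut off
  there instead.\<close>

lemma block_step:
  assumes k: "k \<in> block V E B i" "k \<notin> B" and kj: "{k, j} \<in> E"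
  shows "j \<in> block V E B i"
proof -
  have j: "j \<in> V" using edges kj by (fastforce simp: doubleton_eq_iff)
  obtain p where p: "is_path V E p" "hd p = i" "last p = k" "set (butlast p) \<subseteq> V - B"
    using k by (auto simp: block_def)
  then have ne: "p \<noteq> []" by (simp add: is_path_def)
  have setp: "set p \<subseteq> V - B"
    using p k ne by (subst append_butlast_last_id[symmetric]) (auto simp: is_path_def block_def)
  show ?thesis
  proof (cases "j \<in> set p")
    case True
    then obtain n where n: "n < length p" "p ! n = j" by (auto simp: in_set_conv_nth)
    let ?q = "take (Suc n) p"
    have "is_path V E ?q" using p n by (auto simp: is_path_def dest: in_set_takeD)
    moreover have "hd ?q = i" using p ne by (simp add: hd_take)
    moreover have "last ?q = j" using n by (simp add: take_Suc_conv_app_nth)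
    moreover have "set (butlast ?q) \<subseteq> V - B"
      using setp by (meson in_set_butlastD in_set_takeD subset_iff)
    ultimately show ?thesis using j by (auto simp: block_def)
  next
    case False
    have "is_path V E (p @ [j])"
      unfolding is_path_def
    proof (intro conjI allI impI)
      fix n assume n: "Suc n < length (p @ [j])"
      show "{(p @ [j]) ! n, (p @ [j]) ! Suc n} \<in> E"
      proof (cases "Suc n < length p")
        case True
        then show ?thesis using p by (simp add: is_path_def nth_append)
      next
        case False
        then have "Suc n = length p" using n by simp
        then show ?thesis using p ne kj by (auto simp: nth_append last_conv_nth simp flip: \<open>Suc n = length p\<close>)
      qed
    qed (use False p j in \<open>auto simp: is_path_def\<close>)
    then show ?thesis using p ne setp j by (auto simp: block_def intro!: exI[of _ "p @ [j]"])
  qed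
qed

text \<open>Induction principle for blocks: a path witnessing membership leaves only interior
  vertices, and all its vertices lie in the block, so \<open>P\<close> propagates edge by
  edge.\<close>

lemma block_path:
  assumes i: "i \<in> V - B" and P0: "P i"
    and step: "\<And>k j. k \<in> block V E B i \<Longrightarrow> k \<notin> B \<Longrightarrow> P k \<Longrightarrow> {k, j} \<in> E \<Longrightarrow> P j"
    and j: "j \<in> block V E B i"
  shows "P j"
proof -
  obtain p where p: "is_path V E p" "hd p = i" "last p = j" "set (butlast p) \<subseteq> V - B"
    using j by (auto simp: block_def)
  have ne: "p \<noteq> []" using p by (simp add: is_path_def)
  have "p ! n \<in> block V E B i \<and> P (p ! n)" if "n < length p" for n
    using that
  proof (induction n)
    case 0
    then show ?case using p ne P0 interior_in_own_block[OF i] by (simp add: hd_conv_nth)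
  next
    case (Suc n)
    have "butlast p ! n \<in> set (butlast p)" using Suc.prems by (intro nth_mem) simp
    then have "p ! n \<notin> B" using p(4) Suc.prems by (auto simp: nth_butlast)
    moreover have "{p ! n, p ! Suc n} \<in> E" using p(1) Suc.prems by (simp add: is_path_def)
    ultimately show ?case using step block_step Suc by (meson Suc_lessD)
  qed
  from this[of "length p - 1"] show ?thesis using p ne by (simp add: last_conv_nth)
qed

lemma block_subset:
  assumes "k \<in> V - B" "k \<in> block V E B i"
  shows "block V E B k \<subseteq> block V E B i"
proof
  fix j assume "j \<in> block V E B k"
  then show "j \<in> block V E B i"
    using block_path[of k "\<lambda>j. j \<in> block V E B i" j] block_step assms by blast
qed

lemma block_eq_of_edge:
  assumes "i \<in> V - B" "j \<in> V - B" "{i, j} \<in> E"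
  shows "block V E B i = block V E B j"
  using assms block_subset block_step interior_in_own_block
  by (metis DiffD2 insert_commute subset_antisym)

text \<open>Edges can be traversed both ways, so adjacent interior vertices have the same block;
  this is carried along a path. The property is vacuous at boundary nodes, which may lie in several
  blocks.\<close>

lemma block_eq:
  assumes i: "i \<in> V - B" and j: "j \<in> block V E B i" "j \<notin> B"
  shows "block V E B i = block V E B j"
proof -
  have "j \<notin> B \<longrightarrow> block V E B i = block V E B j"
  proof (rule block_path[OF i, where P = "\<lambda>j. j \<notin> B \<longrightarrow> block V E B i = block V E B j"])
    fix k j assume k: "k \<in> block V E B i" "k \<notin> B" "{k, j} \<in> E"
    then have "j \<in> V" using block_step[OF k] by (simp add: block_def)
    moreover assume "k \<notin> B \<longrightarrow> block V E B i = block V E B k"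
    ultimately show "j \<notin> B \<longrightarrow> block V E B i = block V E B j"
      using block_eq_of_edge[of k j] k by (simp add: block_def)
  qed (use j in simp_all)
  with j show ?thesis by blast
qed

section \<open>Vectors of the edges\<close>

lemma finite_E: "finite E"
proof (rule finite_subset)
  show "E \<subseteq> Pow V" using edges by auto
qed (use finite_V in simp)

text \<open>No edge joins two boundary nodes, so every edge has an interior end and the
  \<open>SOME\<close> in the definition has a witness.\<close>

lemma edge_vec_cases:
  assumes "e \<in> E"
  obtains i j where "e = {i, j}" "i \<in> V - B" "j \<in> V - B"
      "dirichlet_edge_vec V B u e = unit_vec (Some i) - unit_vec (Some j)"
    | i j where "e = {i, j}" "i \<in> V - B" "j \<in> B"
      "dirichlet_edge_vec V B u e = unit_vec (Some i) - fun_scale (u j) (unit_vec None)"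
proof -
  obtain a b where "e = {a, b}" "a \<in> V" "b \<in> V" "a \<noteq> b" using edges assms by blast
  then have "\<exists>i j. e = {i, j} \<and> i \<in> V - B \<and> (j \<in> V - B \<or> j \<in> B)"
    using boundary_nonadjacent[of a b] assms by (metis Diff_iff insert_commute)
  then have "\<exists>w. \<exists>i j. e = {i, j} \<and> i \<in> V - B \<and>
     ((j \<in> V - B \<and> w = unit_vec (Some i) - unit_vec (Some j)) \<or>
      (j \<in> B \<and> w = unit_vec (Some i) - fun_scale (u j) (unit_vec None)))" by blast
  from someI_ex[OF this] show ?thesis
    unfolding dirichlet_edge_vec_def[symmetric] using that by blast
qed

lemma edge_vec_boundary:
  assumes "{i, j} \<in> E" "j \<in> B"
  shows "dirichlet_edge_vec V B u {i, j} = unit_vec (Some i) - fun_scale (u j) (unit_vec None)"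
  using assms by (cases rule: edge_vec_cases[of "{i, j}" u, case_names a b])
    (use assms in \<open>auto simp: doubleton_eq_iff\<close>)

lemma edge_vec_interior:
  assumes "{i, j} \<in> E" "i \<in> V - B" "j \<in> V - B"
  shows "dirichlet_edge_vec V B u {i, j} = unit_vec (Some i) - unit_vec (Some j) \<or>
    dirichlet_edge_vec V B u {i, j} = unit_vec (Some j) - unit_vec (Some i)"
  using assms by (cases rule: edge_vec_cases[of "{i, j}" u, case_names a b])
    (use assms in \<open>auto simp: doubleton_eq_iff\<close>)

section \<open>A representation bounds the boundary of each block\<close>

lemma boundary_neighbour:
  assumes i: "i \<in> V - B" and j: "j \<in> block V E B i \<inter> B"
  shows "\<exists>c\<in>block V E B i - B. {c, j} \<in> E"
proof -
  have "j \<in> B \<longrightarrow> (\<exists>c\<in>block V E B i - B. {c, j} \<in> E)"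
    by (rule block_path[OF i, of "\<lambda>j. j \<in> B \<longrightarrow> (\<exists>c\<in>block V E B i - B. {c, j} \<in> E)"])
      (use i j in auto)
  then show ?thesis using j by blast
qed

text \<open>Independence is tested only on \<open>T\<close> together with at most three further
  elements; \<open>eq\<close> carries these facts to \<open>\<phi>\<close>, where they are read as
  statements about a plane modulo the span of the image of \<open>T\<close>.\<close>

lemma boundary_of_block_lepoll:
  fixes \<phi> :: "'v set option \<Rightarrow> 'i \<Rightarrow> 'k::field"
  assumes inj_u: "inj_on u B" and i0: "i0 \<in> V - B"
    and eq: "\<And>X. X \<subseteq> insert None (Some ` E) \<Longrightarrow>
      indep_family (dirichlet_vec V B u) X \<longleftrightarrow> indep_family \<phi> X"
  shows "block V E B i0 \<inter> B \<lesssim> (UNIV :: 'k set)"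
proof (cases "block V E B i0 \<inter> B = {}")
  case True
  then show ?thesis by simp
next
  case False
  define U where "U = block V E B i0"
  define d where "d = dirichlet_vec V B u"
  define A where "A = {e \<in> E. e \<subseteq> U - B}"
  have U: "U \<subseteq> V" by (auto simp: U_def block_def)
  have dN: "d None = unit_vec None" by (simp add: d_def dirichlet_vec_def)
  have dS: "d (Some e) = dirichlet_edge_vec V B u e" for e by (simp add: d_def dirichlet_vec_def)
  obtain Y where Y: "Y \<subseteq> d ` Some ` A" "fun_vs.independent Y" "d ` Some ` A \<subseteq> fun_vs.span Y"
    using fun_vs.maximal_independent_subset by blast
  \<comment> \<open>\<open>T\<close> takes one edge for each vector of the basis \<open>Y\<close>,
    and so serves as the spanning forest without any graph construction.\<close>
  obtain T where T: "T \<subseteq> Some ` A" "indep_family d T" "d ` Some ` A \<subseteq> fun_vs.span (d ` T)"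
    using Y by (auto simp: subset_image_inj indep_family_def)
  \<comment> \<open>Along a path the differences of consecutive unit vectors telescope.\<close>
  have tree0: "k \<notin> B \<longrightarrow> unit_vec (Some i0) - unit_vec (Some k) \<in> fun_vs.span (d ` T)" (is "?P k")
    if "k \<in> U" for k
  proof (rule block_path[OF i0, where P = ?P])
    show "?P i0" using fun_vs.span_zero[of "d ` T"] by (simp add: zero_fun_def)
    fix k j assume k: "k \<in> block V E B i0" "k \<notin> B" "?P k" and kj: "{k, j} \<in> E"
    have j: "j \<in> U" using block_step[OF k(1,2) kj] by (simp add: U_def)
    show "?P j"
    proof
      assume "j \<notin> B"
      then have "{k, j} \<in> A" using kj j k by (auto simp: A_def U_def)
      then have "d (Some {k, j}) \<in> fun_vs.span (d ` T)" using T(3) by blast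
      moreover have "d (Some {k, j}) = unit_vec (Some k) - unit_vec (Some j) \<or>
          d (Some {k, j}) = unit_vec (Some j) - unit_vec (Some k)"
        unfolding dS using edge_vec_interior[OF kj] j \<open>j \<notin> B\<close> k U by (auto simp: U_def)
      ultimately have "unit_vec (Some k) - unit_vec (Some j) \<in> fun_vs.span (d ` T)"
        by (metis fun_vs.span_neg minus_diff_eq)
      then have "(unit_vec (Some i0) - unit_vec (Some k)) + (unit_vec (Some k) - unit_vec (Some j))
          \<in> fun_vs.span (d ` T)"
        using k by (blast intro: fun_vs.span_add)
      then show "unit_vec (Some i0) - unit_vec (Some j) \<in> fun_vs.span (d ` T)" by simp
    qed
  qed (use that in \<open>simp add: U_def\<close>)
  have tree: "unit_vec (Some i) - unit_vec (Some k) \<in> fun_vs.span (d ` T)"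
    if "i \<in> U - B" "k \<in> U - B" for i k
    using fun_vs.span_diff[of "unit_vec (Some i0) - unit_vec (Some k)" "d ` T"
        "unit_vec (Some i0) - unit_vec (Some i)"] tree0[of i] tree0[of k] that
    by simp
  \<comment> \<open>The pair of functionals (\<open>deg\<close>, coordinate \<open>None\<close>)
    vanishes on the span of \<open>T\<close>, takes the value (0, 1) on \<open>e\<^sub>0\<close> and
    (1, \<open>- u j\<close>) on the edge chosen for \<open>j\<close>. These pairs are pairwise
    linearly independent as \<open>u\<close> is injective.\<close>
  define deg :: "('v option \<Rightarrow> real) \<Rightarrow> real" where "deg = (\<lambda>x. \<Sum>v\<in>V. x (Some v))"
  have deg_lin: "deg (x + y) = deg x + deg y" "deg (x - y) = deg x - deg y"
      "deg (fun_scale r x) = r * deg x" "deg 0 = 0" for x y r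
    by (simp_all add: deg_def sum.distrib sum_subtractf fun_scale_def sum_distrib_left)
  have deg_unit: "deg (unit_vec (Some i)) = (if i \<in> V then 1 else 0)" "deg (unit_vec None) = 0" for i
    using finite_V by (simp_all add: deg_def unit_vec_def if_distrib cong: if_cong)
  have unit_None: "unit_vec (Some i) None = (0 :: real)" for i :: 'v
    by (simp add: unit_vec_def)
  have dT: "deg (d e) = 0 \<and> d e None = 0" if e: "e \<in> T" for e
  proof -
    obtain e' where e': "e = Some e'" "e' \<in> E" "e' \<subseteq> U - B"
      using subsetD[OF T(1) e] by (auto simp: A_def)
    show ?thesis
      using e'(2) by (cases rule: edge_vec_cases[where u = u])
        (use e' unit_None in \<open>auto simp: dS deg_lin deg_unit\<close>)
  qed
  have spanT: "deg x = 0 \<and> x None = 0" if "x \<in> fun_vs.span (d ` T)" for x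
    using that
  proof (induction rule: fun_vs.span_induct_alt)
    case base
    show ?case unfolding deg_lin by simp
  next
    case (step r x y)
    then show ?case unfolding deg_lin using dT by (auto simp: fun_scale_def)
  qed
  \<comment> \<open>One interior neighbour in the block is fixed for each boundary node;
    \<open>f j\<close> is the resulting edge.\<close>
  obtain c where c: "\<And>j. j \<in> U \<inter> B \<Longrightarrow> c j \<in> U - B \<and> {c j, j} \<in> E"
    using boundary_neighbour[OF i0, folded U_def] by metis
  define f where "f = (\<lambda>j. Some {c j, j})"
  have fE: "f j \<in> Some ` E" and fT: "f j \<notin> T" and fN: "f j \<noteq> None"
    and df: "d (f j) = unit_vec (Some (c j)) - fun_scale (u j) (unit_vec None)"
    and deg_f: "deg (d (f j)) = 1" and fNone: "d (f j) None = - u j" if "j \<in> U \<inter> B" for j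
  proof -
    show df: "d (f j) = unit_vec (Some (c j)) - fun_scale (u j) (unit_vec None)"
      using edge_vec_boundary c that by (simp add: f_def dS)
    show "deg (d (f j)) = 1" "d (f j) None = - u j"
      using c[OF that] U by (auto simp: df deg_lin deg_unit) (auto simp: unit_vec_def fun_scale_def)
  qed (use c[OF that] that T(1) in \<open>auto simp: f_def A_def\<close>)
  have f_ne: "f j \<noteq> f j'" if "j \<in> U \<inter> B" "j' \<in> U \<inter> B" "j \<noteq> j'" for j j'
    using that c[of j] c[of j'] by (auto simp: f_def doubleton_eq_iff)
  have TE: "T \<subseteq> Some ` E" using T(1) by (auto simp: A_def)
  have NT: "None \<notin> T" using TE by blast

  have indN: "indep_family d (insert None T)"
    using NT T(2) spanT[of "d None"] by (auto simp: indep_family_insert dN unit_vec_def)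
  have ind1: "indep_family d (insert (f j) (insert None T))" if j: "j \<in> U \<inter> B" for j
  proof -
    have "d (f j) \<notin> fun_vs.span (d ` insert None T)"
    proof
      assume "d (f j) \<in> fun_vs.span (d ` insert None T)"
      then obtain r where "d (f j) - fun_scale r (d None) \<in> fun_vs.span (d ` T)"
        by (auto simp: fun_vs.span_breakdown_eq)
      then show False using spanT deg_f[OF j] by (fastforce simp: deg_lin dN deg_unit)
    qed
    then show ?thesis using indN j fT fN by (subst indep_family_insert) auto
  qed
  have ind2: "indep_family d (insert (f j) (insert (f j') T))"
    if j: "j \<in> U \<inter> B" "j' \<in> U \<inter> B" "j \<noteq> j'" for j j'
  proof -
    have "d (f j') \<notin> fun_vs.span (d ` T)" using spanT deg_f[OF j(2)] by fastforce
    then have "indep_family d (insert (f j') T)"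
      using T(2) fT[OF j(2)] by (simp add: indep_family_insert)
    moreover have "d (f j) \<notin> fun_vs.span (d ` insert (f j') T)"
    proof
      assume "d (f j) \<in> fun_vs.span (d ` insert (f j') T)"
      then obtain r where "d (f j) - fun_scale r (d (f j')) \<in> fun_vs.span (d ` T)"
        by (auto simp: fun_vs.span_breakdown_eq)
      then have "deg (d (f j) - fun_scale r (d (f j'))) = 0 \<and> (d (f j) - fun_scale r (d (f j'))) None = 0"
        by (rule spanT)
      \<comment> \<open>Degrees give \<open>r = 1\<close>; then coordinate \<open>None\<close>
        compares the weights.\<close>
      then have "u j = u j'"
        unfolding deg_lin deg_f[OF j(1)] deg_f[OF j(2)]
        using fNone[OF j(1)] fNone[OF j(2)] by (auto simp: fun_scale_def)
      then show False using inj_u j by (auto simp: inj_on_def)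
    qed
    ultimately show ?thesis using j fT f_ne by (subst indep_family_insert) auto
  qed
  have dep3: "\<not> indep_family d (insert (f j) (insert (f j') (insert None T)))"
    if j: "j \<in> U \<inter> B" "j' \<in> U \<inter> B" "j \<noteq> j'" for j j'
  proof -
    let ?S = "fun_vs.span (d ` insert (f j') (insert None T))"
    \<comment> \<open>Two boundary edges differ by a vector in the span of \<open>T\<close> and a
      multiple of \<open>e\<^sub>0\<close>.\<close>
    have "d (f j) = (unit_vec (Some (c j)) - unit_vec (Some (c j'))) + d (f j')
        + fun_scale (u j' - u j) (d None)"
      using j by (simp add: df dN fun_eq_iff fun_scale_def algebra_simps)
    moreover have "unit_vec (Some (c j)) - unit_vec (Some (c j')) \<in> ?S"
      using tree[of "c j" "c j'"] c j
        fun_vs.span_mono[of "d ` T" "d ` insert (f j') (insert None T)"] by blast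
    moreover have "d (f j') \<in> ?S" "d None \<in> ?S" by (auto intro: fun_vs.span_base)
    ultimately have "d (f j) \<in> ?S"
      by (metis fun_vs.span_add fun_vs.span_scale)
    then show ?thesis
      using j f_ne fT fN by (subst indep_family_insert) auto
  qed

  have eq': "indep_family d X \<longleftrightarrow> indep_family \<phi> X" if "X \<subseteq> insert None (Some ` E)" for X
    using eq that by (simp add: d_def)
  have k1: "\<phi> (f j) \<notin> fun_vs.span (insert (\<phi> None) (\<phi> ` T))" if j: "j \<in> U \<inter> B" for j
  proof -
    have "indep_family \<phi> (insert (f j) (insert None T))"
      using ind1[OF j] eq'[of "insert (f j) (insert None T)"] fE[OF j] TE by blast
    then show ?thesis using fT[OF j] fN[OF j] by (subst (asm) indep_family_insert) auto
  qed
  have k2: "\<phi> (f j) \<notin> fun_vs.span (insert (\<phi> (f j')) (\<phi> ` T))"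
    if j: "j \<in> U \<inter> B" "j' \<in> U \<inter> B" "j \<noteq> j'" for j j'
  proof -
    have "indep_family \<phi> (insert (f j) (insert (f j') T))"
      using ind2[OF j] eq'[of "insert (f j) (insert (f j') T)"] fE[OF j(1)] fE[OF j(2)] TE by blast
    then show ?thesis using fT[OF j(1)] f_ne[OF j] by (subst (asm) indep_family_insert) auto
  qed
  \<comment> \<open>The edge of this reference node and \<open>e\<^sub>0\<close> span the plane,
    modulo \<open>T\<close>, in which all \<open>\<phi> (f j)\<close> have coordinates.\<close>
  obtain b where b: "b \<in> U \<inter> B" using False by (auto simp: U_def)
  have "\<exists>\<alpha> \<beta>. \<phi> (f j) - fun_scale \<alpha> (\<phi> (f b)) - fun_scale \<beta> (\<phi> None) \<in> fun_vs.span (\<phi> ` T)"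
    if j: "j \<in> U \<inter> B" for j
  proof -
    have "\<phi> (f j) \<in> fun_vs.span (\<phi> ` insert (f b) (insert None T))"
    proof (cases "j = b")
      case True
      then show ?thesis by (auto intro: fun_vs.span_base)
    next
      case False
      have "indep_family \<phi> (insert (f b) (insert None T))"
        using ind1[OF b] eq'[of "insert (f b) (insert None T)"] fE[OF b] TE by blast
      moreover have "\<not> indep_family \<phi> (insert (f j) (insert (f b) (insert None T)))"
        using dep3[OF j b False] eq'[of "insert (f j) (insert (f b) (insert None T))"] fE[OF b] fE[OF j] TE
        by blast
      ultimately show ?thesis
        using f_ne[OF j b False] fT[OF j] fN[OF j] by (subst (asm) (2) indep_family_insert) auto
    qed
    then show ?thesis by (simp add: fun_vs.span_breakdown_eq)
  qed
  then obtain \<alpha> \<beta> where \<alpha>\<beta>: "\<And>j. j \<in> U \<inter> B \<Longrightarrow>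
      \<phi> (f j) - fun_scale (\<alpha> j) (\<phi> (f b)) - fun_scale (\<beta> j) (\<phi> None) \<in> fun_vs.span (\<phi> ` T)"
    by metis
  \<comment> \<open>No \<open>f j\<close> is parallel to \<open>e\<^sub>0\<close> modulo
    \<open>T\<close>, so its slope is an element of the field and never infinite.\<close>
  have \<alpha>: "\<alpha> j \<noteq> 0" if j: "j \<in> U \<inter> B" for j
  proof
    assume "\<alpha> j = 0"
    then have "\<phi> (f j) - fun_scale (\<beta> j) (\<phi> None) \<in> fun_vs.span (\<phi> ` T)"
      using \<alpha>\<beta>[OF j] by simp
    then show False using k1[OF j] by (auto simp: fun_vs.span_breakdown_eq)
  qed
  have "inj_on (\<lambda>j. \<beta> j / \<alpha> j) (U \<inter> B)"
  proof (rule inj_onI, rule ccontr)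
    fix j j' assume j: "j \<in> U \<inter> B" "j' \<in> U \<inter> B" and r: "\<beta> j / \<alpha> j = \<beta> j' / \<alpha> j'" and ne: "j \<noteq> j'"
    \<comment> \<open>Equal slopes would make \<open>\<phi> (f j)\<close> equal to \<open>?r\<close>
      times \<open>\<phi> (f j')\<close> modulo \<open>T\<close>, contradicting
      \<open>k2\<close>.\<close>
    let ?r = "\<alpha> j / \<alpha> j'"
    have "?r * \<alpha> j' = \<alpha> j" "?r * \<beta> j' = \<beta> j" using \<alpha> j r by (auto simp: divide_simps mult.commute)
    then have "\<phi> (f j) - fun_scale ?r (\<phi> (f j')) =
      (\<phi> (f j) - fun_scale (\<alpha> j) (\<phi> (f b)) - fun_scale (\<beta> j) (\<phi> None))
      - fun_scale ?r (\<phi> (f j') - fun_scale (\<alpha> j') (\<phi> (f b)) - fun_scale (\<beta> j') (\<phi> None))"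
      by (simp only: fun_vs.scale_right_diff_distrib fun_vs.scale_scale) simp
    also have "\<dots> \<in> fun_vs.span (\<phi> ` T)"
      by (rule fun_vs.span_diff[OF \<alpha>\<beta>[OF j(1)] fun_vs.span_scale[OF \<alpha>\<beta>[OF j(2)]]])
    finally show False using k2[OF j ne] by (auto simp: fun_vs.span_breakdown_eq)
  qed
  then show ?thesis unfolding lepoll_def U_def by blast
qed

section \<open>Constructing a representation from weights on each block\<close>

text \<open>The real vectors and \<open>\<phi>\<close> are label configurations with the same ends
  \<open>s\<close> and \<open>t\<close>. With blocks as classes, weights need to agree in their
  equalities only inside a block, where both \<open>u\<close> and \<open>g\<close> are
  injective.\<close>

lemma representable_of_block_injections:
  fixes g :: "'v set \<Rightarrow> 'v \<Rightarrow> 'k::field"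
  assumes inj_u: "inj_on u B"
    and g: "\<And>i. i \<in> V - B \<Longrightarrow> inj_on (g (block V E B i)) (block V E B i \<inter> B)"
  shows "representable TYPE('k) (dirichlet_matroid V E B u)"
proof -
  let ?b = "block V E B"
  \<comment> \<open>A vertex is labelled together with a block, as a boundary node may lie in several blocks.
    The labels \<open>Inr True\<close> and \<open>Inr False\<close>, of weights 1 and 0, give \<open>e\<^sub>0\<close> as a difference.\<close>
  define I where "I = (\<lambda>i. Inl (?b i, i) :: 'v set \<times> 'v + bool) ` (V - B)"
  define L where "L = {Inl (?b i, j) | i j. i \<in> V - B \<and> j \<in> ?b i} \<union> range (Inr :: bool \<Rightarrow> 'v set \<times> 'v + bool)"
  obtain h where h: "bij_betw h V {0..<card V}" using ex_bij_betw_finite_nat[OF finite_V] by blast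
  define \<kappa>1 where "\<kappa>1 = case_sum (\<lambda>(_ :: 'v set, v :: 'v). Some v) (\<lambda>_ :: bool. None)"
  \<comment> \<open>The shift by \<open>Suc\<close> reserves coordinate 0 for the boundary
    direction, so \<open>Suc (card V)\<close> coordinates suffice.\<close>
  define \<kappa>2 where "\<kappa>2 = case_sum (\<lambda>(_ :: 'v set, v). Suc (h v)) (\<lambda>_ :: bool. 0)"
  define u1 where "u1 = case_sum (\<lambda>(_ :: 'v set, v). u v) (of_bool :: bool \<Rightarrow> real)"
  define u2 where "u2 = case_sum (\<lambda>(U, v). g U v) (of_bool :: bool \<Rightarrow> 'k)"
  \<comment> \<open>The class \<open>None\<close> holds just the two labels of
    \<open>e\<^sub>0\<close>, so their weights 1 and 0, distinct in every field, are never compared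
    with those of boundary nodes.\<close>
  define cls where "cls = case_sum (\<lambda>(U :: 'v set, _ :: 'v). Some U) (\<lambda>_ :: bool. None)"
  let ?f = "label_vec \<kappa>1 None I u1"
  \<comment> \<open>An interior vertex of a block has that same block as its own, so its label lies
    in \<open>I\<close>.\<close>
  have boundary_L: "j \<in> B" if "Inl (?b i, j) \<notin> I" "i \<in> V - B" "j \<in> ?b i" for i j
  proof (rule ccontr)
    assume "j \<notin> B"
    then have j: "j \<in> V - B" using that by (auto simp: block_def)
    have "?b j = ?b i" using block_eq that \<open>j \<notin> B\<close> by simp
    then show False using that j by (auto simp: I_def)
  qed
  have "\<exists>i j. e = {i, j} \<and> i \<in> V - B \<and> dirichlet_edge_vec V B u e = ?f (Inl (?b i, i)) - ?f (Inl (?b i, j))"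
    if "e \<in> E" for e
    using that
  proof (cases rule: edge_vec_cases[where u = u])
    case (1 i j)
    then have "?b i = ?b j" using block_eq_of_edge that by blast
    then have "Inl (?b i, i) \<in> I" "Inl (?b i, j) \<in> I" using 1 by (auto simp: I_def)
    then show ?thesis using 1 by (auto simp: label_vec_def \<kappa>1_def)
  next
    case (2 i j)
    then have "Inl (?b i, i) \<in> I" "Inl (?b i, j) \<notin> I" by (auto simp: I_def)
    then show ?thesis using 2 by (auto simp: label_vec_def \<kappa>1_def u1_def)
  qed
  then obtain p q where pq: "\<And>e. e \<in> E \<Longrightarrow> e = {p e, q e} \<and> p e \<in> V - B \<and>
      dirichlet_edge_vec V B u e = ?f (Inl (?b (p e), p e)) - ?f (Inl (?b (p e), q e))"
    by metis
  define s where "s = case_option (Inr True) (\<lambda>e. Inl (?b (p e), p e))"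
  define t where "t = case_option (Inr False) (\<lambda>e. Inl (?b (p e), q e))"
  define \<phi> where "\<phi> = (\<lambda>x. label_vec \<kappa>2 0 I u2 (s x) - label_vec \<kappa>2 0 I u2 (t x))"
  let ?S = "insert None (Some ` E)"
  have d: "dirichlet_vec V B u x = ?f (s x) - ?f (t x)" if "x \<in> ?S" for x
  proof (cases x)
    case None
    then show ?thesis
      by (auto simp: dirichlet_vec_def s_def t_def label_vec_def I_def u1_def fun_scale_def)
  next
    case (Some e)
    then show ?thesis using that pq[of e] by (auto simp: dirichlet_vec_def s_def t_def)
  qed
  have st: "s x \<in> L \<and> t x \<in> L \<and> cls (s x) = cls (t x)" if "x \<in> ?S" for x
  proof (cases x)
    case None
    then show ?thesis by (auto simp: s_def t_def L_def cls_def)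
  next
    case (Some e)
    then have e: "e \<in> E" using that by auto
    have "p e \<in> ?b (p e)" using interior_in_own_block pq[OF e] by blast
    moreover have "q e \<in> ?b (p e)" using block_step[of "p e" "p e" "q e"] calculation pq[OF e] e by auto
    ultimately show ?thesis using pq[OF e] Some by (auto simp: s_def t_def L_def cls_def)
  qed
  have indep_iff: "indep_family (dirichlet_vec V B u) X \<longleftrightarrow> indep_family \<phi> X" if X: "X \<subseteq> ?S" for X
  proof -
    have "indep_family (dirichlet_vec V B u) X \<longleftrightarrow> indep_family (\<lambda>x. ?f (s x) - ?f (t x)) X"
      using d X by (intro indep_family_cong) blast
    also have "\<dots> \<longleftrightarrow> indep_family \<phi> X"
      unfolding \<phi>_def
    proof (rule indep_family_label_vec_eq[where L = L and cls = cls])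
      show "finite X" using X finite_E finite_subset by blast
      show "inj_on \<kappa>1 I" "None \<notin> \<kappa>1 ` I" "0 \<notin> \<kappa>2 ` I"
        by (auto simp: I_def \<kappa>1_def \<kappa>2_def inj_on_def)
      show "inj_on \<kappa>2 I"
        using h by (auto simp: I_def \<kappa>2_def inj_on_def bij_betw_def)
      fix l l' assume l: "l \<in> L - I" "l' \<in> L - I" "cls l = cls l'"
      show "u1 l = u1 l' \<longleftrightarrow> u2 l = u2 l'"
      proof (cases l)
        case (Inr x)
        then show ?thesis using l by (cases l') (auto simp: cls_def u1_def u2_def)
      next
        case (Inl y)
        then obtain i j where i: "l = Inl (?b i, j)" "i \<in> V - B" "j \<in> ?b i"
          using l by (auto simp: L_def)
        moreover obtain j' where j': "l' = Inl (?b i, j')" "j' \<in> ?b i"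
          using l i by (auto simp: L_def cls_def)
        moreover have "j \<in> B" "j' \<in> B" using boundary_L[of i] i j' l by auto
        ultimately show ?thesis
          using inj_u g[of i] by (auto simp: u1_def u2_def inj_on_def)
      qed
    qed (use st X in blast)
    finally show ?thesis .
  qed
  have zero: "\<phi> x n = 0" if x: "x \<in> ?S" and n: "n \<ge> Suc (card V)" for x n
  proof -
    have "\<not> card V \<le> h i" if "i \<in> V" for i
      using bij_betwE[OF h] that by fastforce
    then have "label_vec \<kappa>2 0 I u2 l n = 0" for l
      using n by (auto simp: label_vec_def unit_vec_def fun_scale_def I_def \<kappa>2_def)
    then show ?thesis by (simp add: \<phi>_def)
  qed
  have eq: "dirichlet_matroid V E B u = vector_matroid ?S \<phi>"
    unfolding dirichlet_matroid_def vector_matroid_def using indep_iff by auto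
  have fst: "fst (dirichlet_matroid V E B u) = ?S"
    by (simp add: dirichlet_matroid_def vector_matroid_def)
  show ?thesis
    unfolding representable_def fst
    by (intro exI[of _ "Suc (card V)"] exI[of _ \<phi>]) (use zero eq in blast)
qed

end

section \<open>Passing between the maximum and the single blocks\<close>

text \<open>The size condition is an injection into \<open>UNIV\<close> because the field may be
  infinite, where \<open>card\<close> would give 0.\<close>

theorem theorem2p18:
  fixes V :: "'v set" and E :: "'v set set" and B :: "'v set" and u :: "'v \<Rightarrow> real"
  assumes "network V E B"
    and "inj_on u B"
  shows "representable TYPE('k::field) (dirichlet_matroid V E B u) \<longleftrightarrow>
    {..<Max ((\<lambda>U. card (U \<inter> B)) ` blocks V E B)} \<lesssim> (UNIV :: 'k set)"
proof -
  interpret network V E B by fact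
  let ?c = "\<lambda>U. card (U \<inter> B)" and ?S = "insert None (Some ` E)"
  have fin: "finite (blocks V E B)" and ne: "blocks V E B \<noteq> {}"
    using finite_V boundary by (auto simp: blocks_def)
  have card_eq: "{..<?c U} \<approx> U \<inter> B" for U
    by (rule eqpoll_sym, rule eqpoll_iff_card[THEN iffD2])
      (use finite_V boundary in \<open>auto intro: finite_subset\<close>)
  show ?thesis
  proof
    assume "representable TYPE('k) (dirichlet_matroid V E B u)"
    then obtain \<phi> :: "'v set option \<Rightarrow> nat \<Rightarrow> 'k" where
      "dirichlet_matroid V E B u = vector_matroid ?S \<phi>"
      by (auto simp: representable_def dirichlet_matroid_def vector_matroid_def)
    then have eq: "indep_family (dirichlet_vec V B u) X \<longleftrightarrow> indep_family \<phi> X" if "X \<subseteq> ?S" for X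
      using that by (auto simp: dirichlet_matroid_def vector_matroid_def set_eq_iff)
    \<comment> \<open>The bound for a single block is applied to one that attains the
      maximum.\<close>
    have "Max (?c ` blocks V E B) \<in> ?c ` blocks V E B" using fin ne by simp
    then obtain i where i: "i \<in> V - B" "Max (?c ` blocks V E B) = ?c (block V E B i)"
      by (auto simp: blocks_def)
    have "block V E B i \<inter> B \<lesssim> (UNIV :: 'k set)"
      by (rule boundary_of_block_lepoll[OF assms(2) i(1) eq])
    then show "{..<Max (?c ` blocks V E B)} \<lesssim> (UNIV :: 'k set)"
      unfolding i(2) using card_eq lepoll_trans1 by blast
  next
    assume large: "{..<Max (?c ` blocks V E B)} \<lesssim> (UNIV :: 'k set)"
    have "\<exists>g :: 'v \<Rightarrow> 'k. inj_on g (U \<inter> B)" if "U \<in> blocks V E B" for U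
    proof -
      have "?c U \<le> Max (?c ` blocks V E B)" using fin that by simp
      then have "{..<?c U} \<lesssim> {..<Max (?c ` blocks V E B)}" by (intro subset_imp_lepoll) auto
      then have "U \<inter> B \<lesssim> (UNIV :: 'k set)"
        using card_eq large by (meson eqpoll_sym lepoll_trans lepoll_trans1)
      then show ?thesis by (auto simp: lepoll_def)
    qed
    then obtain g :: "'v set \<Rightarrow> 'v \<Rightarrow> 'k" where "\<And>U. U \<in> blocks V E B \<Longrightarrow> inj_on (g U) (U \<inter> B)"
      by metis
    then show "representable TYPE('k) (dirichlet_matroid V E B u)"
      by (intro representable_of_block_injections[OF assms(2), where g = g]) (simp add: blocks_def)
  qed
qed

end
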